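(* Let $J$ be a block Jacobi matrix with Jacobi parameters $(A_n,B_n)_{n\ge1}$. If $J$ belongs to the Nevai class and is of type 1 or of type 3, then $A_n\to\mathbf 1$ as $n\to\infty$.
   Context: Fix $l\ge1$; $^\dagger$ is the Hermitian adjoint and $\mathbf 1$ the $l\times l$ identity matrix. A block Jacobi matrix with Jacobi parameters $(A_n,B_n)_{n\ge1}$ (complex $l\times l$ matrices with $B_n=B_n^\dagger$, $\det A_n\ne0$) is the block tridiagonal matrix with $J_{nn}=B_n$, $J_{n,n+1}=A_n$, $J_{n+1,n}=A_n^\dagger$ and all other blocks zero. It is of type 1 if every $A_n$ is Hermitian positive definite; it is of type 3 if every $A_n$ is lower triangular with strictly positive diagonal elements. It belongs to the Nevai class if $B_n\to 0$ and $A_n^\dagger A_n\to\mathbf 1$ as $n\to\infty$. *)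

theory Defs
  imports "HOL-Analysis.Analysis"
begin

type_synonym 'l square_matrix = "complex^'l^'l"

definition hermitian_adjoint :: "complex^'n^'m \<Rightarrow> complex^'m^'n" where
  "hermitian_adjoint A = (\<chi> i j. cnj (A $ j $ i))"

definition hermitian :: "'l::finite square_matrix \<Rightarrow> bool" where
  "hermitian A \<longleftrightarrow> hermitian_adjoint A = A"

(* For Hermitian A the form is real valued, so taking Re loses nothing. *)
definition hermitian_posdef :: "'l::finite square_matrix \<Rightarrow> bool" where
  "hermitian_posdef A \<longleftrightarrow> hermitian A \<and>
     (\<forall>x. x \<noteq> 0 \<longrightarrow> 0 < Re (\<Sum>i\<in>UNIV. cnj (x $ i) * (A *v x) $ i))"

definition lower_triangular :: "'l::{finite,linorder} square_matrix \<Rightarrow> bool" where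
  "lower_triangular A \<longleftrightarrow> (\<forall>i j. i < j \<longrightarrow> A $ i $ j = 0)"

definition positive_diagonal :: "'l::finite square_matrix \<Rightarrow> bool" where
  "positive_diagonal A \<longleftrightarrow> (\<forall>i. A $ i $ i \<in> \<real> \<and> 0 < Re (A $ i $ i))"

(* Semi-infinite block matrices are indexed by positive naturals; blocks and
   parameters with index 0 are junk and left unconstrained. *)
type_synonym 'l block_matrix = "nat \<Rightarrow> nat \<Rightarrow> 'l square_matrix"

definition block_jacobi_matrix ::
    "'l::finite block_matrix \<Rightarrow> (nat \<Rightarrow> 'l square_matrix) \<Rightarrow> (nat \<Rightarrow> 'l square_matrix) \<Rightarrow> bool" where
  "block_jacobi_matrix J A B \<longleftrightarrow>
     (\<forall>n\<ge>1. hermitian (B n) \<and> det (A n) \<noteq> 0) \<and>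
     (\<forall>m\<ge>1. \<forall>n\<ge>1. J m n =
        (if m = n then B n
         else if n = m + 1 then A m
         else if m = n + 1 then hermitian_adjoint (A n)
         else 0))"

(* The Jacobi parameters are determined by the matrix, so properties
   of the parameters are properties of J. *)
abbreviation jacobi_A :: "'l::finite block_matrix \<Rightarrow> nat \<Rightarrow> 'l square_matrix" where
  "jacobi_A J n \<equiv> J n (n + 1)"

abbreviation jacobi_B :: "'l::finite block_matrix \<Rightarrow> nat \<Rightarrow> 'l square_matrix" where
  "jacobi_B J n \<equiv> J n n"

definition type_1 :: "'l::finite block_matrix \<Rightarrow> bool" where
  "type_1 J \<longleftrightarrow> (\<forall>n\<ge>1. hermitian_posdef (jacobi_A J n))"

definition type_3 :: "'l::{finite,linorder} block_matrix \<Rightarrow> bool" where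
  "type_3 J \<longleftrightarrow>
     (\<forall>n\<ge>1. lower_triangular (jacobi_A J n) \<and> positive_diagonal (jacobi_A J n))"

definition nevai_class :: "'l::finite block_matrix \<Rightarrow> bool" where
  "nevai_class J \<longleftrightarrow>
     (\<lambda>n. jacobi_B J n) \<longlonglongrightarrow> 0 \<and>
     (\<lambda>n. hermitian_adjoint (jacobi_A J n) ** jacobi_A J n) \<longlonglongrightarrow> mat 1"

end

theory Submission
  imports Defs
begin

text \<open>
  If $A^\dagger A$ is close to $\mathbf 1$, then $A$ is close to a unitary matrix, and the
  normalisation (type 1 or type 3) must single out $\mathbf 1$ among the unitaries, stably
  under limits. Both cases recover $A$ from $A^\dagger A$ by a procedure that is continuous at $\mathbf 1$.

  For type 1, $A^\dagger A = A^2$ and $A^2 - \mathbf 1 = (A + \mathbf 1)(A - \mathbf 1)$.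
  Positivity of $A$ gives $\langle z, (A + \mathbf 1) z\rangle \ge \|z\|^2$, so $A + \mathbf 1$
  never shrinks a vector, and each column of $A - \mathbf 1$ is no longer than the same column of
  $A^2 - \mathbf 1$ (\<open>posdef_column_diff_le\<close>).

  For type 3, $A^\dagger A$ is the product of an upper and a lower triangular matrix, and the
  factor $A$ can be read off row by row, starting from the last one, as in a Cholesky
  factorisation. Each step only takes the root of a number near $1$ and divides by that root, so the
  convergence of $A^\dagger A$ passes to the rows of $A$ (\<open>lower_triangular_tendsto_mat_1\<close>).
\<close>

lemma hermitian_adjoint_mult_nth:
  "(hermitian_adjoint A ** B) $ i $ j = (\<Sum>k\<in>UNIV. cnj (A $ k $ i) * B $ k $ j)"
  by (simp add: matrix_matrix_mult_def hermitian_adjoint_def)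

lemma inner_complex_vec_eq: "x \<bullet> y = Re (\<Sum>i\<in>UNIV. cnj (x $ i) * y $ i)"
  for x y :: "complex^'n"
  by (simp add: inner_vec_def inner_complex_def)

lemma hermitian_posdef_inner_nonneg:
  assumes "hermitian_posdef A"
  shows "0 \<le> x \<bullet> (A *v x)"
  using assms by (cases "x = 0") (force simp: hermitian_posdef_def inner_complex_vec_eq)+

text \<open>
  Write $z$ for the left-hand column. The right-hand one is $w = (A + \mathbf 1) z$, so
  $\langle z, w\rangle \ge \|z\|^2$ by positivity, and Cauchy-Schwarz gives $\|z\| \le \|w\|$.
  This is a quantitative form of the fact that $\mathbf 1$ is its own only positive square root.
\<close>

lemma posdef_column_diff_le:
  fixes A :: "'l::finite square_matrix"
  assumes "hermitian_posdef A"
  shows "norm (column j (A - mat 1)) \<le> norm (column j (A ** A - mat 1))"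
proof -
  let ?z = "column j (A - mat 1)" and ?w = "column j (A ** A - mat 1)"
  have "A ** A - mat 1 = A ** (A - mat 1) + (A - mat 1)"
    by (simp add: vec_eq_iff matrix_matrix_mult_def mat_def right_diff_distrib sum_subtractf
        if_distrib[of "(*) _"] cong: if_cong)
  hence "?w = A *v ?z + ?z"
    by (simp add: vec_eq_iff column_def matrix_matrix_mult_def matrix_vector_mult_def)
  hence "?z \<bullet> ?w = ?z \<bullet> (A *v ?z) + ?z \<bullet> ?z"
    by (simp add: inner_add_right)
  hence "norm ?z * norm ?z \<le> ?z \<bullet> ?w"
    using hermitian_posdef_inner_nonneg[OF assms, of ?z]
    by (simp add: dot_square_norm power2_eq_square)
  also have "\<dots> \<le> norm ?z * norm ?w"
    by (rule norm_cauchy_schwarz)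
  finally show ?thesis
    by (cases "?z = 0") simp_all
qed

lemma posdef_tendsto_mat_1:
  fixes A :: "'a \<Rightarrow> 'l::finite square_matrix"
  assumes posdef: "\<forall>\<^sub>F n in F. hermitian_posdef (A n)"
    and lim: "((\<lambda>n. hermitian_adjoint (A n) ** A n) \<longlongrightarrow> mat 1) F"
  shows "(A \<longlongrightarrow> mat 1) F"
proof (intro vec_tendstoI)
  fix i j :: 'l
  have "((\<lambda>n. column j (hermitian_adjoint (A n) ** A n - mat 1)) \<longlongrightarrow> column j (mat 1 - mat 1)) F"
    unfolding column_def by (intro tendsto_intros lim)
  hence "((\<lambda>n. norm (column j (hermitian_adjoint (A n) ** A n - mat 1))) \<longlongrightarrow> 0) F"
    by (intro tendsto_norm_zero) (simp add: column_def zero_vec_def)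
  moreover have "\<forall>\<^sub>F n in F. norm (A n $ i $ j - mat 1 $ i $ j)
      \<le> norm (column j (hermitian_adjoint (A n) ** A n - mat 1))"
    using posdef
  proof eventually_elim
    case (elim n)
    have "norm (A n $ i $ j - mat 1 $ i $ j) \<le> norm (column j (A n - mat 1))"
      using Finite_Cartesian_Product.norm_nth_le[of "column j (A n - mat 1)" i] by (simp add: column_def)
    also have "\<dots> \<le> norm (column j (A n ** A n - mat 1))"
      by (rule posdef_column_diff_le[OF elim])
    finally show ?case
      using elim by (simp add: hermitian_posdef_def hermitian_def)
  qed
  ultimately have "((\<lambda>n. A n $ i $ j - mat 1 $ i $ j) \<longlongrightarrow> 0) F"
    by (rule Lim_null_comparison[rotated])
  thus "((\<lambda>n. A n $ i $ j) \<longlongrightarrow> mat 1 $ i $ j) F"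
    by (simp add: LIM_zero_iff)
qed

lemma tendsto_1_of_cnj_mult_self:
  fixes a :: "'a \<Rightarrow> complex"
  assumes pos: "\<forall>\<^sub>F n in F. a n \<in> \<real> \<and> 0 < Re (a n)"
    and lim: "((\<lambda>n. cnj (a n) * a n) \<longlongrightarrow> 1) F"
  shows "(a \<longlongrightarrow> 1) F"
proof -
  have "((\<lambda>n. complex_of_real (sqrt (Re (cnj (a n) * a n)))) \<longlongrightarrow> of_real (sqrt (Re 1))) F"
    by (intro tendsto_intros lim)
  moreover have "\<forall>\<^sub>F n in F. complex_of_real (sqrt (Re (cnj (a n) * a n))) = a n"
    using pos by eventually_elim (auto simp: complex_is_Real_iff complex_eq_iff)
  ultimately show ?thesis
    by (simp add: tendsto_cong)
qed

text \<open>
  In the entry $(A^\dagger A)_{kj} = \sum_i \overline{A_{ik}} A_{ij}$ the terms with $i < k$ vanish.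
  The term $i = k$ contains the unknown entry $A_{kj}$, and the remaining ones involve later rows
  only. Hence the rows are determined in descending order.
\<close>

lemma lower_triangular_tendsto_mat_1:
  fixes A :: "'a \<Rightarrow> 'l::{finite,linorder} square_matrix"
  assumes lower: "\<forall>\<^sub>F n in F. lower_triangular (A n)"
    and diag: "\<forall>\<^sub>F n in F. positive_diagonal (A n)"
    and lim: "((\<lambda>n. hermitian_adjoint (A n) ** A n) \<longlongrightarrow> mat 1) F"
  shows "(A \<longlongrightarrow> mat 1) F"
proof -
  have row: "((\<lambda>n. A n $ k $ j) \<longlongrightarrow> mat 1 $ k $ j) F" for k j
  proof (induction "card {k<..}" arbitrary: k j rule: less_induct)
    case less
    have later: "((\<lambda>n. A n $ i $ j) \<longlongrightarrow> mat 1 $ i $ j) F" if "k < i" for i j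
    proof (rule less)
      show "card {i<..} < card {k<..}"
        using that by (intro psubset_card_mono) auto
    qed
    \<comment> \<open>The contribution of the later rows to row \<open>k\<close> of $A^\dagger A$ vanishes in the limit,
        because column \<open>k\<close> of $\mathbf 1$ is zero there.\<close>
    have product: "((\<lambda>n. cnj (A n $ k $ k) * A n $ k $ j) \<longlongrightarrow> mat 1 $ k $ j) F" for j
    proof -
      have "((\<lambda>n. (hermitian_adjoint (A n) ** A n) $ k $ j
              - (\<Sum>i\<in>{k<..}. cnj (A n $ i $ k) * A n $ i $ j))
            \<longlongrightarrow> mat 1 $ k $ j - (\<Sum>i\<in>{k<..}. cnj (mat 1 $ i $ k) * mat 1 $ i $ j)) F"
        by (intro tendsto_intros lim later) auto
      moreover have "(\<Sum>i\<in>{k<..}. cnj ((mat 1 :: 'l square_matrix) $ i $ k) * mat 1 $ i $ j) = 0"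
        by (intro sum.neutral) (auto simp: mat_def)
      moreover have "\<forall>\<^sub>F n in F. (hermitian_adjoint (A n) ** A n) $ k $ j
          - (\<Sum>i\<in>{k<..}. cnj (A n $ i $ k) * A n $ i $ j) = cnj (A n $ k $ k) * A n $ k $ j"
        using lower
      proof eventually_elim
        case (elim n)
        have "(hermitian_adjoint (A n) ** A n) $ k $ j
            = (\<Sum>i\<in>insert k {k<..}. cnj (A n $ i $ k) * A n $ i $ j)"
          unfolding hermitian_adjoint_mult_nth using elim
          by (intro sum.mono_neutral_right) (auto simp: lower_triangular_def not_less_iff_gr_or_eq)
        thus ?case
          by simp
      qed
      ultimately show ?thesis
        by (simp add: tendsto_cong)
    qed
    have diagonal: "((\<lambda>n. A n $ k $ k) \<longlongrightarrow> 1) F"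
    proof (rule tendsto_1_of_cnj_mult_self)
      show "\<forall>\<^sub>F n in F. A n $ k $ k \<in> \<real> \<and> 0 < Re (A n $ k $ k)"
        using diag by eventually_elim (simp add: positive_diagonal_def)
      show "((\<lambda>n. cnj (A n $ k $ k) * A n $ k $ k) \<longlongrightarrow> 1) F"
        using product[of k] by (simp add: mat_def)
    qed
    have "((\<lambda>n. cnj (A n $ k $ k) * A n $ k $ j / cnj (A n $ k $ k)) \<longlongrightarrow> mat 1 $ k $ j / cnj 1) F"
      by (intro tendsto_divide product tendsto_cnj diagonal) simp
    moreover have "\<forall>\<^sub>F n in F. cnj (A n $ k $ k) * A n $ k $ j / cnj (A n $ k $ k) = A n $ k $ j"
      using diag
    proof eventually_elim
      case (elim n)
      hence "A n $ k $ k \<noteq> 0"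
        by (metis positive_diagonal_def less_irrefl zero_complex.sel(1))
      thus ?case
        by simp
    qed
    ultimately show ?case
      by (simp add: tendsto_cong)
  qed
  show ?thesis
    by (intro vec_tendstoI row)
qed

theorem theorem2p9:
  fixes J :: "'l::{finite,linorder} block_matrix"
    and A B :: "nat \<Rightarrow> 'l square_matrix"
  assumes "block_jacobi_matrix J A B"
    and "nevai_class J"
    and "type_1 J \<or> type_3 J"
  shows "A \<longlonglongrightarrow> mat 1"
proof -
  have lim: "(\<lambda>n. hermitian_adjoint (jacobi_A J n) ** jacobi_A J n) \<longlonglongrightarrow> mat 1"
    using assms(2) by (simp add: nevai_class_def)
  from assms(3) have "(\<lambda>n. jacobi_A J n) \<longlonglongrightarrow> mat 1"
  proof
    assume "type_1 J"
    hence "\<forall>\<^sub>F n in sequentially. hermitian_posdef (jacobi_A J n)"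
      unfolding type_1_def eventually_sequentially by blast
    thus ?thesis
      using lim by (rule posdef_tendsto_mat_1)
  next
    assume "type_3 J"
    hence "\<forall>\<^sub>F n in sequentially. lower_triangular (jacobi_A J n)"
      and "\<forall>\<^sub>F n in sequentially. positive_diagonal (jacobi_A J n)"
      unfolding type_3_def eventually_sequentially by blast+
    thus ?thesis
      using lim by (rule lower_triangular_tendsto_mat_1)
  qed
  moreover have "\<forall>\<^sub>F n in sequentially. jacobi_A J n = A n"
    using eventually_ge_at_top[of 1]
  proof eventually_elim
    case (elim n)
    thus ?case
      using assms(1) by (simp add: block_jacobi_matrix_def)
  qed
  ultimately show ?thesis
    by (rule Lim_transform_eventually)
qed

end
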